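(* Let $(M,g)$ be a Riemannian manifold of dimension $n$. Then $(\widetilde{TM},\tilde g_2,\tilde Q)$ is a (pseudo-Riemannian) almost product manifold; that is, $\tilde Q^2=I$ and $\tilde g_2(\tilde QX,\tilde QY)=\tilde g_2(X,Y)$ for all vector fields $X,Y$ on $\widetilde{TM}$.
   Context: Let $(x^i)$ be local coordinates on $M$, $(x^i,y^i)$ the induced coordinates on $TM$, $\widetilde{TM}=TM\setminus\{0\}$ the tangent bundle minus its zero section, $g_{ij}$ the components of $g$, $\Gamma_{ij}{}^k$ the Christoffel symbols of its Levi-Civita connection; the summation convention is used. Put $\|y\|=\sqrt{g_{ij}(x)y^iy^j}$. Define the local frame $X_i=\frac{\partial}{\partial x^i}-y^a\Gamma_{ai}{}^m\frac{\partial}{\partial y^m}$, $X_{\bar i}=\frac{\partial}{\partial y^i}$ of $T\widetilde{TM}$, with dual coframe $dx^i$, $\delta y^i=dy^i+y^a\Gamma_{aj}{}^i dx^j$. The pseudo-Riemannian metric $\tilde g_2=\frac{2}{\|y\|}g_{ij}(x)\,dx^i\,\delta y^j$ is the symmetric tensor with $\tilde g_2(X_i,X_j)=0=\tilde g_2(X_{\bar i},X_{\bar j})$ and $\tilde g_2(X_i,X_{\bar j})=\tilde g_2(X_{\bar j},X_i)=\frac{2}{\|y\|}g_{ij}$. $\tilde Q$ is the $(1,1)$ tensor field on $\widetilde{TM}$ given by $\tilde Q(X_i)=\|y\|X_{\bar i}$, $\tilde Q(X_{\bar i})=\frac1{\|y\|}X_i$. *)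

theory Defs
  imports "HOL-Analysis.Analysis"
begin

section \<open>Smooth maps and smooth manifolds\<close>

text \<open>In the following two definitions \<open>S\<close> is meant to be open.\<close>

primrec Ck_on :: "nat \<Rightarrow> 'a::real_normed_vector set \<Rightarrow> ('a \<Rightarrow> 'b::real_normed_vector) \<Rightarrow> bool" where
  "Ck_on 0 S f \<longleftrightarrow> continuous_on S f"
| "Ck_on (Suc k) S f \<longleftrightarrow> (\<forall>x\<in>S. f differentiable (at x)) \<and>
     (\<forall>v. Ck_on k S (\<lambda>x. frechet_derivative f (at x) v))"

definition smooth_on :: "'a::real_normed_vector set \<Rightarrow> ('a \<Rightarrow> 'b::real_normed_vector) \<Rightarrow> bool" where
  "smooth_on S f \<longleftrightarrow> (\<forall>k. Ck_on k S f)"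

text \<open>A chart is a pair of its domain and its coordinate map; the values of the map outside
  the domain are irrelevant.\<close>

type_synonym ('m, 'e) chart = "'m set \<times> ('m \<Rightarrow> 'e)"

definition chart_inv :: "('m, 'e) chart \<Rightarrow> 'e \<Rightarrow> 'm" where
  "chart_inv c = inv_into (fst c) (snd c)"

definition transition :: "('m, 'e) chart \<Rightarrow> ('m, 'e) chart \<Rightarrow> 'e \<Rightarrow> 'e" where
  "transition c d = snd d \<circ> chart_inv c"

definition charts_at :: "('m, 'e) chart set \<Rightarrow> 'm \<Rightarrow> ('m, 'e) chart set" where
  "charts_at A p = {c \<in> A. p \<in> fst c}"

definition smooth_manifold :: "'m topology \<Rightarrow> ('m, 'e::euclidean_space) chart set \<Rightarrow> bool" where
  "smooth_manifold X A \<longleftrightarrow>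
     Hausdorff_space X \<and>
     (\<exists>\<B>. countable \<B> \<and> (\<forall>V\<in>\<B>. openin X V) \<and>
        (\<forall>U x. openin X U \<and> x \<in> U \<longrightarrow> (\<exists>V\<in>\<B>. x \<in> V \<and> V \<subseteq> U))) \<and>
     (\<Union>c\<in>A. fst c) = topspace X \<and>
     (\<forall>c\<in>A. openin X (fst c) \<and> open (snd c ` fst c) \<and>
        homeomorphic_map (subtopology X (fst c)) (top_of_set (snd c ` fst c)) (snd c)) \<and>
     (\<forall>c\<in>A. \<forall>d\<in>A. smooth_on (snd c ` (fst c \<inter> fst d)) (transition c d))"


section \<open>Tangent vectors\<close>

text \<open>Jacobian at \<open>p\<close> of the change of coordinates from \<open>c\<close> to \<open>d\<close>.\<close>

definition jac :: "('m, 'e::real_normed_vector) chart \<Rightarrow> ('m, 'e) chart \<Rightarrow> 'm \<Rightarrow> 'e \<Rightarrow> 'e" where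
  "jac c d p = frechet_derivative (transition c d) (at (snd c p))"

text \<open>A tangent vector at \<open>p\<close> is the family of its coordinate representations in all charts around
  \<open>p\<close>, related by the contravariant transformation law. Families are put to \<open>0\<close> on the
  other charts, so that equality of families is equality of tangent vectors and the vector
  space operations are the pointwise ones.\<close>

type_synonym ('m, 'e) tvec = "('m, 'e) chart \<Rightarrow> 'e"

definition tangent_space ::
  "('m, 'e::real_normed_vector) chart set \<Rightarrow> 'm \<Rightarrow> ('m, 'e) tvec set" where
  "tangent_space A p = {v.
     (\<forall>c\<in>charts_at A p. \<forall>d\<in>charts_at A p. v d = jac c d p (v c)) \<and>
     (\<forall>c. c \<notin> charts_at A p \<longrightarrow> v c = 0)}"

text \<open>The tangent vector at \<open>p\<close> with components \<open>e\<close> in the chart \<open>c\<close>; for the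
  \<open>i\<close>-th standard basis vector this is the coordinate vector field of \<open>x\<^sup>i\<close> at \<open>p\<close>.\<close>

definition coord_vec ::
  "('m, 'e::real_normed_vector) chart set \<Rightarrow> ('m, 'e) chart \<Rightarrow> 'm \<Rightarrow> 'e \<Rightarrow> ('m, 'e) tvec" where
  "coord_vec A c p e = (\<lambda>d. if d \<in> charts_at A p then jac c d p e else 0)"

definition smooth_vector_field ::
  "('m, 'e::real_normed_vector) chart set \<Rightarrow> ('m \<Rightarrow> ('m, 'e) tvec) \<Rightarrow> bool" where
  "smooth_vector_field A V \<longleftrightarrow>
     (\<forall>p\<in>(\<Union>c\<in>A. fst c). V p \<in> tangent_space A p) \<and>
     (\<forall>c\<in>A. smooth_on (snd c ` fst c) (\<lambda>x. V (chart_inv c x) c))"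


section \<open>Riemannian metrics\<close>

type_synonym ('m, 'e) cov2 = "'m \<Rightarrow> ('m, 'e) tvec \<Rightarrow> ('m, 'e) tvec \<Rightarrow> real"

text \<open>The components \<open>g\<^sub>i\<^sub>j\<close> in the chart \<open>c\<close>, as functions of the coordinates.\<close>

definition metric_comp ::
  "('m, real^'n) chart set \<Rightarrow> ('m, real^'n) cov2 \<Rightarrow> ('m, real^'n) chart \<Rightarrow> 'n \<Rightarrow> 'n \<Rightarrow> real^'n \<Rightarrow> real"
  where
  "metric_comp A g c i j x =
     g (chart_inv c x) (coord_vec A c (chart_inv c x) (axis i 1))
                       (coord_vec A c (chart_inv c x) (axis j 1))"

definition riemannian_metric :: "('m, real^'n) chart set \<Rightarrow> ('m, real^'n) cov2 \<Rightarrow> bool" where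
  "riemannian_metric A g \<longleftrightarrow>
     (\<forall>p\<in>(\<Union>c\<in>A. fst c).
        (\<forall>u\<in>tangent_space A p. \<forall>v\<in>tangent_space A p. g p u v = g p v u) \<and>
        (\<forall>u\<in>tangent_space A p. \<forall>v\<in>tangent_space A p. \<forall>w\<in>tangent_space A p. \<forall>a b.
           g p (\<lambda>c. a *\<^sub>R u c + b *\<^sub>R v c) w = a * g p u w + b * g p v w) \<and>
        (\<forall>u\<in>tangent_space A p. u \<noteq> (\<lambda>_. 0) \<longrightarrow> g p u u > 0)) \<and>
     (\<forall>c\<in>A. \<forall>i j. smooth_on (snd c ` fst c) (metric_comp A g c i j))"

text \<open>The Christoffel symbol \<open>\<Gamma>\<^sub>i\<^sub>j\<^sup>k\<close> of the Levi-Civita connection in the chart \<open>c\<close>.\<close>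

definition christoffel ::
  "('m, real^'n) chart set \<Rightarrow> ('m, real^'n) cov2 \<Rightarrow> ('m, real^'n) chart \<Rightarrow>
     'n \<Rightarrow> 'n \<Rightarrow> 'n \<Rightarrow> real^'n \<Rightarrow> real" where
  "christoffel A g c i j k x =
     (let D = (\<lambda>a f. frechet_derivative f (at x) (axis a 1));
          G = metric_comp A g c;
          Ginv = matrix_inv (\<chi> a b. G a b x)
      in 1/2 * (\<Sum>l\<in>UNIV. Ginv $ k $ l * (D i (G j l) + D j (G i l) - D l (G i j))))"


section \<open>The slit tangent bundle\<close>

definition slit_tangent_bundle ::
  "('m, 'e::real_normed_vector) chart set \<Rightarrow> ('m \<times> ('m, 'e) tvec) set" where
  "slit_tangent_bundle A =
     {(p, v). p \<in> (\<Union>c\<in>A. fst c) \<and> v \<in> tangent_space A p \<and> v \<noteq> (\<lambda>_. 0)}"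

text \<open>The induced coordinates \<open>(x\<^sup>i, y\<^sup>i)\<close>.\<close>

definition lift_chart ::
  "('m, 'e::real_normed_vector) chart set \<Rightarrow> ('m, 'e) chart \<Rightarrow>
     ('m \<times> ('m, 'e) tvec, 'e \<times> 'e) chart" where
  "lift_chart A c =
     ({u \<in> slit_tangent_bundle A. fst u \<in> fst c}, \<lambda>u. (snd c (fst u), snd u c))"

definition lift_atlas ::
  "('m, 'e::real_normed_vector) chart set \<Rightarrow> ('m \<times> ('m, 'e) tvec, 'e \<times> 'e) chart set" where
  "lift_atlas A = lift_chart A ` A"

type_synonym ('m, 'n) tm_point = "'m \<times> ('m, real^'n) tvec"
type_synonym ('m, 'n) tm_vec = "(('m, 'n) tm_point, (real^'n) \<times> (real^'n)) tvec"

definition fibre_norm ::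
  "('m, real^'n) chart set \<Rightarrow> ('m, real^'n) cov2 \<Rightarrow> ('m, real^'n) chart \<Rightarrow> ('m, 'n) tm_point \<Rightarrow> real"
  where
  "fibre_norm A g c u =
     sqrt (\<Sum>i\<in>UNIV. \<Sum>j\<in>UNIV. metric_comp A g c i j (snd c (fst u)) * snd u c $ i * snd u c $ j)"

text \<open>The adapted frame: \<open>vertical A c i\<close> is \<open>\<partial>/\<partial>y\<^sup>i\<close> and \<open>horizontal A g c i\<close> is
  \<open>\<partial>/\<partial>x\<^sup>i - y\<^sup>a \<Gamma>\<^sub>a\<^sub>i\<^sup>m \<partial>/\<partial>y\<^sup>m\<close>.\<close>

definition vertical ::
  "('m, real^'n) chart set \<Rightarrow> ('m, real^'n) chart \<Rightarrow> 'n \<Rightarrow> ('m, 'n) tm_point \<Rightarrow> ('m, 'n) tm_vec"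
  where
  "vertical A c i u = coord_vec (lift_atlas A) (lift_chart A c) u (0, axis i 1)"

definition horizontal ::
  "('m, real^'n) chart set \<Rightarrow> ('m, real^'n) cov2 \<Rightarrow> ('m, real^'n) chart \<Rightarrow> 'n \<Rightarrow>
     ('m, 'n) tm_point \<Rightarrow> ('m, 'n) tm_vec" where
  "horizontal A g c i u = (\<lambda>d.
     coord_vec (lift_atlas A) (lift_chart A c) u (axis i 1, 0) d -
     (\<Sum>a\<in>UNIV. \<Sum>m\<in>UNIV.
        (snd u c $ a * christoffel A g c a i m (snd c (fst u))) *\<^sub>R vertical A c m u d))"

text \<open>The dual coframe \<open>dx\<^sup>i\<close>, \<open>\<delta>y\<^sup>i = dy\<^sup>i + y\<^sup>a \<Gamma>\<^sub>a\<^sub>j\<^sup>i dx\<^sup>j\<close>.\<close>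

definition dx :: "('m, real^'n) chart set \<Rightarrow> ('m, real^'n) chart \<Rightarrow> 'n \<Rightarrow> ('m, 'n) tm_vec \<Rightarrow> real"
  where
  "dx A c i \<xi> = fst (\<xi> (lift_chart A c)) $ i"

definition \<delta>y ::
  "('m, real^'n) chart set \<Rightarrow> ('m, real^'n) cov2 \<Rightarrow> ('m, real^'n) chart \<Rightarrow> 'n \<Rightarrow>
     ('m, 'n) tm_point \<Rightarrow> ('m, 'n) tm_vec \<Rightarrow> real" where
  "\<delta>y A g c i u \<xi> = snd (\<xi> (lift_chart A c)) $ i +
     (\<Sum>a\<in>UNIV. \<Sum>j\<in>UNIV.
        snd u c $ a * christoffel A g c a j i (snd c (fst u)) * dx A c j \<xi>)"

text \<open>The product in \<open>2/\<parallel>y\<parallel> g\<^sub>i\<^sub>j dx\<^sup>i \<delta>y\<^sup>j\<close> is the symmetric one without the factor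
  \<open>1/2\<close>, so that the pairing of \<open>X\<^sub>i\<close> with the \<open>j\<close>-th vertical vector is \<open>2/\<parallel>y\<parallel> g\<^sub>i\<^sub>j\<close>.\<close>

definition g2_chart ::
  "('m, real^'n) chart set \<Rightarrow> ('m, real^'n) cov2 \<Rightarrow> ('m, real^'n) chart \<Rightarrow>
     ('m, 'n) tm_point \<Rightarrow> ('m, 'n) tm_vec \<Rightarrow> ('m, 'n) tm_vec \<Rightarrow> real" where
  "g2_chart A g c u \<xi> \<eta> = 2 / fibre_norm A g c u *
     (\<Sum>i\<in>UNIV. \<Sum>j\<in>UNIV. metric_comp A g c i j (snd c (fst u)) *
        (dx A c i \<xi> * \<delta>y A g c j u \<eta> + dx A c i \<eta> * \<delta>y A g c j u \<xi>))"

definition Q_chart ::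
  "('m, real^'n) chart set \<Rightarrow> ('m, real^'n) cov2 \<Rightarrow> ('m, real^'n) chart \<Rightarrow>
     ('m, 'n) tm_point \<Rightarrow> ('m, 'n) tm_vec \<Rightarrow> ('m, 'n) tm_vec" where
  "Q_chart A g c u \<xi> = (\<lambda>d. \<Sum>i\<in>UNIV.
     (dx A c i \<xi> * fibre_norm A g c u) *\<^sub>R vertical A c i u d +
     (\<delta>y A g c i u \<xi> * (1 / fibre_norm A g c u)) *\<^sub>R horizontal A g c i u d)"

text \<open>The global tensor fields. The choice of the chart does not matter (\<open>g2_tilde_chart\<close> and
  \<open>Q_tilde_chart\<close> below); the values on the adapted frame of any chart are computed in
  \<open>g2_tilde_frame\<close> and \<open>Q_tilde_frame\<close>.\<close>

definition some_chart :: "('m, 'e) chart set \<Rightarrow> 'm \<Rightarrow> ('m, 'e) chart" where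
  "some_chart A p = (SOME c. c \<in> charts_at A p)"

definition g2_tilde ::
  "('m, real^'n) chart set \<Rightarrow> ('m, real^'n) cov2 \<Rightarrow> (('m, 'n) tm_point, (real^'n) \<times> (real^'n)) cov2" where
  "g2_tilde A g u = g2_chart A g (some_chart A (fst u)) u"

definition Q_tilde ::
  "('m, real^'n) chart set \<Rightarrow> ('m, real^'n) cov2 \<Rightarrow> ('m, 'n) tm_point \<Rightarrow>
     ('m, 'n) tm_vec \<Rightarrow> ('m, 'n) tm_vec" where
  "Q_tilde A g u = Q_chart A g (some_chart A (fst u)) u"


section \<open>Independence of the chart\<close>

subsection \<open>Changes of coordinates\<close>

definition nice_atlas :: "('m, 'e::euclidean_space) chart set \<Rightarrow> bool" where
  "nice_atlas A \<longleftrightarrow>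
     (\<forall>c\<in>A. inj_on (snd c) (fst c)) \<and>
     (\<forall>c\<in>A. \<forall>d\<in>A. open (snd c ` (fst c \<inter> fst d)) \<and>
        (\<forall>x\<in>snd c ` (fst c \<inter> fst d). transition c d differentiable (at x)))"

lemma chart_inv_eq:
  assumes "nice_atlas A" "c \<in> A" "p \<in> fst c"
  shows "chart_inv c (snd c p) = p"
  using assms by (simp add: nice_atlas_def chart_inv_def)

lemma transition_eq:
  assumes "nice_atlas A" "c \<in> A" "p \<in> fst c"
  shows "transition c d (snd c p) = snd d p"
  using chart_inv_eq[OF assms] by (simp add: transition_def)

lemma jac_deriv:
  assumes "nice_atlas A" "c \<in> charts_at A p" "d \<in> charts_at A p"
  shows "(transition c d has_derivative jac c d p) (at (snd c p))"
  using assms unfolding nice_atlas_def charts_at_def jac_def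
  by (simp add: frechet_derivative_works)

lemma jac_linear:
  assumes "nice_atlas A" "c \<in> charts_at A p" "d \<in> charts_at A p"
  shows "linear (jac c d p)"
  using has_derivative_linear[OF jac_deriv[OF assms]] .

lemma jac_chain:
  assumes A: "nice_atlas A" and c: "c \<in> charts_at A p" and d: "d \<in> charts_at A p"
    and e: "e \<in> charts_at A p"
  shows "jac d e p (jac c d p v) = jac c e p v"
proof -
  have t: "transition c d (snd c p) = snd d p"
    using transition_eq[OF A] c by (simp add: charts_at_def)
  have "(transition d e has_derivative jac d e p) (at (transition c d (snd c p)))"
    unfolding t by (rule jac_deriv[OF A d e])
  from diff_chain_at[OF jac_deriv[OF A c d] this]
  have 1: "(transition d e \<circ> transition c d has_derivative jac d e p \<circ> jac c d p) (at (snd c p))" .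
  have "(transition c e has_derivative jac d e p \<circ> jac c d p) (at (snd c p))"
  proof (rule has_derivative_transform_within_open[OF 1])
    show "open (snd c ` (fst c \<inter> fst d))" using A c d unfolding nice_atlas_def charts_at_def by blast
    show "snd c p \<in> snd c ` (fst c \<inter> fst d)" using c d by (auto simp: charts_at_def)
    fix x assume "x \<in> snd c ` (fst c \<inter> fst d)"
    then obtain q where q: "q \<in> fst c" "q \<in> fst d" "x = snd c q" by auto
    then show "(transition d e \<circ> transition c d) x = transition c e x"
      using transition_eq[OF A, of c q] transition_eq[OF A, of d q] c d by (auto simp: charts_at_def)
  qed
  from has_derivative_unique[OF this jac_deriv[OF A c e]] show ?thesis by (metis comp_apply)
qed

lemma jac_self:
  assumes A: "nice_atlas A" and c: "c \<in> charts_at A p"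
  shows "jac c c p v = v"
proof -
  have "(transition c c has_derivative id) (at (snd c p))"
  proof (rule has_derivative_transform_within_open[OF has_derivative_id])
    show "open (snd c ` (fst c \<inter> fst c))" using A c unfolding nice_atlas_def charts_at_def by blast
    show "snd c p \<in> snd c ` (fst c \<inter> fst c)" using c by (auto simp: charts_at_def)
    fix x assume "x \<in> snd c ` (fst c \<inter> fst c)"
    then show "id x = transition c c x"
      using transition_eq[OF A, of c _ c] c by (auto simp: charts_at_def)
  qed
  from has_derivative_unique[OF this jac_deriv[OF A c c]] show ?thesis by (metis id_apply)
qed

lemma coord_vec_mem:
  assumes "nice_atlas A" "c \<in> charts_at A p"
  shows "coord_vec A c p e \<in> tangent_space A p"
  using assms by (auto simp: tangent_space_def coord_vec_def jac_chain)

lemma coord_vec_self: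
  assumes "nice_atlas A" "c \<in> charts_at A p"
  shows "coord_vec A c p e c = e"
  using assms by (simp add: coord_vec_def jac_self)

lemma tangent_jac:
  assumes "v \<in> tangent_space A p" "c \<in> charts_at A p" "d \<in> charts_at A p"
  shows "v d = jac c d p (v c)"
  using assms unfolding tangent_space_def by blast

lemma tangent_eq_coord:
  assumes "nice_atlas A" "c \<in> charts_at A p" "v \<in> tangent_space A p"
  shows "v = coord_vec A c p (v c)"
proof
  fix d show "v d = coord_vec A c p (v c) d"
  proof (cases "d \<in> charts_at A p")
    case True
    then show ?thesis using tangent_jac[OF assms(3,2) True] by (simp only: coord_vec_def if_True)
  next
    case False
    moreover have "v d = 0" using False assms(3) unfolding tangent_space_def by blast
    ultimately show ?thesis by (simp add: coord_vec_def)
  qed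
qed

lemma tangent_eqI:
  assumes "nice_atlas A" "c \<in> charts_at A p" "v \<in> tangent_space A p" "w \<in> tangent_space A p" "v c = w c"
  shows "v = w"
  by (subst tangent_eq_coord[OF assms(1,2,3)], subst tangent_eq_coord[OF assms(1,2,4)]) (simp only: assms(5))

lemma coord_vec_change:
  assumes "nice_atlas A" "c \<in> charts_at A p" "d \<in> charts_at A p"
  shows "coord_vec A d p (jac c d p e) = coord_vec A c p e"
  using assms by (auto simp: coord_vec_def jac_chain fun_eq_iff)

lemma coord_vec_lin:
  assumes "nice_atlas A" "c \<in> charts_at A p"
  shows "coord_vec A c p (a *\<^sub>R e + b *\<^sub>R e') = (\<lambda>d. a *\<^sub>R coord_vec A c p e d + b *\<^sub>R coord_vec A c p e' d)"
proof
  fix d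
  show "coord_vec A c p (a *\<^sub>R e + b *\<^sub>R e') d = a *\<^sub>R coord_vec A c p e d + b *\<^sub>R coord_vec A c p e' d"
  proof (cases "d \<in> charts_at A p")
    case True
    then show ?thesis using jac_linear[OF assms True] by (simp only: coord_vec_def if_True linear_add linear_scale)
  qed (simp add: coord_vec_def)
qed

lemma coord_vec_zero:
  assumes "nice_atlas A" "c \<in> charts_at A p"
  shows "coord_vec A c p 0 = (\<lambda>_. 0)"
  using coord_vec_lin[OF assms, of 0 0 0 0] by simp

lemma coord_vec_linear:
  assumes "nice_atlas A" "c \<in> charts_at A p"
  shows "linear (\<lambda>e. coord_vec A c p e d)"
  using jac_linear[OF assms, of d] by (cases "d \<in> charts_at A p") (simp_all add: coord_vec_def linear_zero)

lemma tangent_lin: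
  assumes "nice_atlas A" "v \<in> tangent_space A p" "w \<in> tangent_space A p"
  shows "(\<lambda>c. a *\<^sub>R v c + b *\<^sub>R w c) \<in> tangent_space A p"
proof -
  have "a *\<^sub>R v d + b *\<^sub>R w d = jac c d p (a *\<^sub>R v c + b *\<^sub>R w c)"
    if "c \<in> charts_at A p" "d \<in> charts_at A p" for c d
    using tangent_jac[OF assms(2) that] tangent_jac[OF assms(3) that] jac_linear[OF assms(1) that]
    by (simp only: linear_add linear_scale)
  moreover have "a *\<^sub>R v d + b *\<^sub>R w d = 0" if "d \<notin> charts_at A p" for d
  proof -
    have "v d = 0" "w d = 0" using that assms(2,3) unfolding tangent_space_def by blast+
    then show ?thesis by simp
  qed
  ultimately show ?thesis unfolding tangent_space_def by blast
qed

lemma smooth_onD1: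
  assumes "smooth_on S f" "x \<in> S"
  shows "(f has_derivative frechet_derivative f (at x)) (at x)"
proof -
  have "Ck_on (Suc 0) S f" using assms(1) unfolding smooth_on_def by blast
  then show ?thesis using assms(2) by (simp add: frechet_derivative_works)
qed

lemma smooth_onD2:
  assumes "smooth_on S f"
  shows "smooth_on S (\<lambda>x. frechet_derivative f (at x) v)"
proof -
  have "Ck_on k S (\<lambda>x. frechet_derivative f (at x) v)" for k
  proof -
    have "Ck_on (Suc k) S f" using assms unfolding smooth_on_def by blast
    then show ?thesis by simp
  qed
  then show ?thesis unfolding smooth_on_def by blast
qed

lemma smooth_on_cont: "smooth_on S f \<Longrightarrow> continuous_on S f"
  unfolding smooth_on_def by (metis Ck_on.simps(1))

lemma manifoldD:
  assumes "smooth_manifold X A" "c \<in> A"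
  shows "openin X (fst c)" "open (snd c ` fst c)"
    "homeomorphic_map (subtopology X (fst c)) (top_of_set (snd c ` fst c)) (snd c)"
    "d \<in> A \<Longrightarrow> smooth_on (snd c ` (fst c \<inter> fst d)) (transition c d)"
  using assms unfolding smooth_manifold_def by blast+

lemma manifold_overlap_open:
  assumes M: "smooth_manifold X A" and c: "c \<in> A" and d: "d \<in> A"
  shows "open (snd c ` (fst c \<inter> fst d))"
proof -
  note o = manifoldD(1)[OF M c] manifoldD(1)[OF M d] manifoldD(2)[OF M c]
    and h = manifoldD(3)[OF M c]
  have "openin (subtopology X (fst c)) (fst c \<inter> fst d)"
    using o by (simp add: openin_subtopology_Int2 openin_open_subtopology openin_Int)
  with h have "openin (top_of_set (snd c ` fst c)) (snd c ` (fst c \<inter> fst d))"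
    using homeomorphic_imp_open_map open_map_def by blast
  with o(3) show ?thesis using openin_open_eq by blast
qed

lemma manifold_nice:
  assumes M: "smooth_manifold X A"
  shows "nice_atlas A"
  unfolding nice_atlas_def
proof (intro conjI ballI)
  fix c assume c: "c \<in> A"
  note h = manifoldD(3)[OF M c] and o = manifoldD(1)[OF M c]
  have "topspace (subtopology X (fst c)) = fst c"
    using o openin_subset by fastforce
  then show "inj_on (snd c) (fst c)"
    using homeomorphic_imp_injective_map[OF h] by simp
next
  fix c d assume "c \<in> A" "d \<in> A"
  then show "open (snd c ` (fst c \<inter> fst d))" using manifold_overlap_open[OF M] by blast
next
  fix c d x assume "c \<in> A" "d \<in> A" "x \<in> snd c ` (fst c \<inter> fst d)"
  then show "transition c d differentiable (at x)"
    using smooth_onD1[OF manifoldD(4)[OF M]] unfolding differentiable_def by blast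
qed

subsection \<open>Symmetry of second derivatives\<close>

lemma mixed_difference:
  fixes h :: "'a::real_normed_vector \<Rightarrow> real"
  assumes S: "ball x r \<subseteq> S"
    and D: "\<And>y. y \<in> S \<Longrightarrow> (h has_derivative D y) (at y)"
    and D2: "\<And>y. y \<in> S \<Longrightarrow> ((\<lambda>z. D z v) has_derivative H y) (at y)"
    and t: "0 < t" "t * (norm v + norm w) < r"
  shows "\<exists>\<xi>\<in>ball x r. h (x + t *\<^sub>R v + t *\<^sub>R w) - h (x + t *\<^sub>R v) - h (x + t *\<^sub>R w) + h x = t * t * H \<xi> w"
proof -
  have inb: "x + s *\<^sub>R v + s' *\<^sub>R w \<in> ball x r" if "0 \<le> s" "s \<le> t" "0 \<le> s'" "s' \<le> t" for s s'
  proof -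
    have "norm (s *\<^sub>R v + s' *\<^sub>R w) \<le> s * norm v + s' * norm w"
      using norm_triangle_ineq[of "s *\<^sub>R v" "s' *\<^sub>R w"] that by simp
    also have "\<dots> \<le> t * norm v + t * norm w"
      using that by (intro add_mono mult_right_mono) auto
    also have "\<dots> < r" using t by (simp add: algebra_simps)
    finally have "norm (- (s *\<^sub>R v + s' *\<^sub>R w)) < r" by (simp only: norm_minus_cancel)
    moreover have "x - (x + s *\<^sub>R v + s' *\<^sub>R w) = - (s *\<^sub>R v + s' *\<^sub>R w)" by simp
    ultimately show ?thesis by (simp only: mem_ball dist_norm)
  qed
  define \<psi> where "\<psi> s = h (x + s *\<^sub>R v + t *\<^sub>R w) - h (x + s *\<^sub>R v + 0 *\<^sub>R w)" for s
  have d\<psi>: "(\<psi> has_derivative (\<lambda>k. D (x + s *\<^sub>R v + t *\<^sub>R w) (k *\<^sub>R v) - D (x + s *\<^sub>R v + 0 *\<^sub>R w) (k *\<^sub>R v))) (at s)"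
    if "0 \<le> s" "s \<le> t" for s
  proof -
    have *: "((\<lambda>s. h (x + s *\<^sub>R v + s' *\<^sub>R w)) has_derivative (\<lambda>k. D (x + s *\<^sub>R v + s' *\<^sub>R w) (k *\<^sub>R v))) (at s)"
      if "0 \<le> s'" "s' \<le> t" for s'
    proof -
      have "(h has_derivative D (x + s *\<^sub>R v + s' *\<^sub>R w)) (at (x + s *\<^sub>R v + s' *\<^sub>R w))"
        by (rule D, rule subsetD[OF S], rule inb) (use that \<open>0 \<le> s\<close> \<open>s \<le> t\<close> in auto)
      moreover have "((\<lambda>s. x + s *\<^sub>R v + s' *\<^sub>R w) has_derivative (\<lambda>k. k *\<^sub>R v)) (at s)"
        by (auto intro!: derivative_eq_intros)
      ultimately have "(h \<circ> (\<lambda>s. x + s *\<^sub>R v + s' *\<^sub>R w) has_derivative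
          D (x + s *\<^sub>R v + s' *\<^sub>R w) \<circ> (\<lambda>k. k *\<^sub>R v)) (at s)"
        by (intro diff_chain_at)
      then show ?thesis by (simp only: o_def)
    qed
    show ?thesis unfolding \<psi>_def using t by (intro has_derivative_diff *) auto
  qed
  obtain s where s: "0 < s" "s < t"
    and es: "\<psi> t - \<psi> 0 = D (x + s *\<^sub>R v + t *\<^sub>R w) ((t - 0) *\<^sub>R v) - D (x + s *\<^sub>R v + 0 *\<^sub>R w) ((t - 0) *\<^sub>R v)"
    using mvt_simple[OF t(1) has_derivative_at_withinI[OF d\<psi>]] by force
  define \<phi> where "\<phi> s' = D (x + s *\<^sub>R v + s' *\<^sub>R w) v" for s'
  have d\<phi>: "(\<phi> has_derivative (\<lambda>k. H (x + s *\<^sub>R v + s' *\<^sub>R w) (k *\<^sub>R w))) (at s')"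
    if "0 \<le> s'" "s' \<le> t" for s'
  proof -
    have "((\<lambda>z. D z v) has_derivative H (x + s *\<^sub>R v + s' *\<^sub>R w)) (at (x + s *\<^sub>R v + s' *\<^sub>R w))"
      by (rule D2, rule subsetD[OF S], rule inb) (use that s in auto)
    moreover have "((\<lambda>s'. x + s *\<^sub>R v + s' *\<^sub>R w) has_derivative (\<lambda>k. k *\<^sub>R w)) (at s')"
      by (auto intro!: derivative_eq_intros)
    ultimately have "((\<lambda>z. D z v) \<circ> (\<lambda>s'. x + s *\<^sub>R v + s' *\<^sub>R w) has_derivative
        H (x + s *\<^sub>R v + s' *\<^sub>R w) \<circ> (\<lambda>k. k *\<^sub>R w)) (at s')"
      by (intro diff_chain_at)
    then show ?thesis unfolding o_def \<phi>_def[abs_def] .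
  qed
  obtain s' where s': "0 < s'" "s' < t"
    and es': "\<phi> t - \<phi> 0 = H (x + s *\<^sub>R v + s' *\<^sub>R w) ((t - 0) *\<^sub>R w)"
    using mvt_simple[OF t(1) has_derivative_at_withinI[OF d\<phi>]] by force
  have in1: "x + s *\<^sub>R v + s' *\<^sub>R w \<in> ball x r" "x + s *\<^sub>R v + t *\<^sub>R w \<in> ball x r" "x + s *\<^sub>R v + 0 *\<^sub>R w \<in> ball x r"
    using s s' t by (intro inb; simp)+
  have lD: "linear (D y)" if "y \<in> ball x r" for y
    by (rule has_derivative_linear[OF D[OF subsetD[OF S that]]])
  have lH: "linear (H y)" if "y \<in> ball x r" for y
    by (rule has_derivative_linear[OF D2[OF subsetD[OF S that]]])
  have "\<psi> t - \<psi> 0 = t * (\<phi> t - \<phi> 0)"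
    using es linear_scale[OF lD[OF in1(2)], of t v] linear_scale[OF lD[OF in1(3)], of t v]
    by (simp add: \<phi>_def right_diff_distrib)
  also have "\<dots> = t * t * H (x + s *\<^sub>R v + s' *\<^sub>R w) w"
    using es' linear_scale[OF lH[OF in1(1)], of t w] by simp
  finally show ?thesis
    using in1(1) by (intro bexI[of _ "x + s *\<^sub>R v + s' *\<^sub>R w"]) (auto simp: \<psi>_def)
qed

lemma abs_aux:
  fixes a p q :: real
  assumes "\<bar>a - p\<bar> < \<bar>p - q\<bar> / 2" "\<bar>a - q\<bar> < \<bar>p - q\<bar> / 2"
  shows False
  using assms by (auto simp: abs_if field_simps split: if_splits)

lemma second_derivative_symmetric_real:
  fixes h :: "'a::real_normed_vector \<Rightarrow> real"
  assumes S: "open S" "x \<in> S"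
    and D: "\<And>y. y \<in> S \<Longrightarrow> (h has_derivative D y) (at y)"
    and D2: "\<And>y v. y \<in> S \<Longrightarrow> ((\<lambda>z. D z v) has_derivative H v y) (at y)"
    and C: "\<And>v w. continuous_on S (\<lambda>y. H v y w)"
  shows "H v x w = H w x v"
proof (rule ccontr)
  assume ne: "H v x w \<noteq> H w x v"
  define e where "e = \<bar>H v x w - H w x v\<bar> / 2"
  have e: "e > 0" using ne by (simp add: e_def)
  have "isCont (\<lambda>y. H v y w) x" "isCont (\<lambda>y. H w y v) x"
    by (rule continuous_on_interior[OF C], simp add: interior_open S)+
  then obtain r1 r2 where r1: "r1 > 0" "\<And>y. dist y x < r1 \<Longrightarrow> dist (H v y w) (H v x w) < e"
    and r2: "r2 > 0" "\<And>y. dist y x < r2 \<Longrightarrow> dist (H w y v) (H w x v) < e"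
    using e unfolding continuous_at_eps_delta by metis
  obtain r3 where r3: "r3 > 0" "ball x r3 \<subseteq> S" using S openE by blast
  define r where "r = min r1 (min r2 r3)"
  have r: "r > 0" "ball x r \<subseteq> S" "r \<le> r1" "r \<le> r2" using r1 r2 r3 by (auto simp: r_def)
  define t where "t = r / (2 * (norm v + norm w + 1))"
  have nn: "norm v + norm w + 1 > 0" by (intro add_nonneg_pos add_nonneg_nonneg) auto
  have t: "t > 0" using r nn by (simp add: t_def)
  have "t * (norm v + norm w) \<le> t * (norm v + norm w + 1)" using t by simp
  also have "\<dots> = r / 2" using nn by (simp add: t_def field_simps)
  also have "\<dots> < r" using r by simp
  finally have tr: "t * (norm v + norm w) < r" "t * (norm w + norm v) < r" by (simp_all add: add.commute)
  obtain \<xi> where x1: "\<xi> \<in> ball x r"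
    "h (x + t *\<^sub>R v + t *\<^sub>R w) - h (x + t *\<^sub>R v) - h (x + t *\<^sub>R w) + h x = t * t * H v \<xi> w"
    using mixed_difference[OF r(2) D D2 t tr(1)] by blast
  obtain \<eta> where x2: "\<eta> \<in> ball x r"
    "h (x + t *\<^sub>R w + t *\<^sub>R v) - h (x + t *\<^sub>R w) - h (x + t *\<^sub>R v) + h x = t * t * H w \<eta> v"
    using mixed_difference[OF r(2) D D2 t tr(2)] by blast
  have "t * t * H v \<xi> w = t * t * H w \<eta> v"
    unfolding x1(2)[symmetric] x2(2)[symmetric] by (simp add: algebra_simps)
  then have "H v \<xi> w = H w \<eta> v" using t by simp
  moreover have "dist (H v \<xi> w) (H v x w) < e" "dist (H w \<eta> v) (H w x v) < e"
    using x1(1) x2(1) r r1(2) r2(2) by (auto simp: dist_commute)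
  ultimately show False unfolding e_def dist_real_def using abs_aux by metis
qed

lemma second_derivative_symmetric:
  fixes F :: "'a::euclidean_space \<Rightarrow> 'b::euclidean_space"
  assumes S: "open S" "x \<in> S" and F: "smooth_on S F"
  shows "frechet_derivative (\<lambda>z. frechet_derivative F (at z) v) (at x) w =
         frechet_derivative (\<lambda>z. frechet_derivative F (at z) w) (at x) v"
proof (rule euclidean_eqI)
  fix b :: 'b assume "b \<in> Basis"
  show "frechet_derivative (\<lambda>z. frechet_derivative F (at z) v) (at x) w \<bullet> b =
        frechet_derivative (\<lambda>z. frechet_derivative F (at z) w) (at x) v \<bullet> b"
  proof (rule second_derivative_symmetric_real[OF S, where h="\<lambda>y. F y \<bullet> b"
        and D="\<lambda>y v. frechet_derivative F (at y) v \<bullet> b"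
        and H="\<lambda>v y w. frechet_derivative (\<lambda>z. frechet_derivative F (at z) v) (at y) w \<bullet> b"])
    fix y v assume "y \<in> S"
    show "((\<lambda>y. F y \<bullet> b) has_derivative (\<lambda>v. frechet_derivative F (at y) v \<bullet> b)) (at y)"
      by (rule has_derivative_inner_left[OF smooth_onD1[OF F \<open>y \<in> S\<close>]])
    show "((\<lambda>z. frechet_derivative F (at z) v \<bullet> b) has_derivative
        (\<lambda>w. frechet_derivative (\<lambda>z. frechet_derivative F (at z) v) (at y) w \<bullet> b)) (at y)"
      by (rule has_derivative_inner_left[OF smooth_onD1[OF smooth_onD2[OF F] \<open>y \<in> S\<close>]])
  next
    fix v w
    show "continuous_on S (\<lambda>y. frechet_derivative (\<lambda>z. frechet_derivative F (at z) v) (at y) w \<bullet> b)"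
      by (intro continuous_intros smooth_on_cont smooth_onD2 F)
  qed
qed

subsection \<open>The transformation law of the Christoffel symbols\<close>

lemma linear_expand:
  fixes f :: "real^'n \<Rightarrow> 'b::real_vector"
  assumes "linear f"
  shows "f v = (\<Sum>i\<in>UNIV. v $ i *\<^sub>R f (axis i 1))"
proof -
  have "f v = f (\<Sum>i\<in>UNIV. v $ i *\<^sub>R axis i 1)"
    using basis_expansion[of v] by (simp add: scalar_mult_eq_scaleR)
  then show ?thesis by (simp only: linear_sum[OF assms] linear_scale[OF assms])
qed

definition met :: "('m, real^'n) chart set \<Rightarrow> ('m, real^'n) cov2 \<Rightarrow> ('m, real^'n) chart \<Rightarrow>
    real^'n \<Rightarrow> real^'n \<Rightarrow> real^'n \<Rightarrow> real" where
  "met A g c x v w = (\<Sum>i\<in>UNIV. \<Sum>j\<in>UNIV. metric_comp A g c i j x * v $ i * w $ j)"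

definition dmet :: "('m, real^'n) chart set \<Rightarrow> ('m, real^'n) cov2 \<Rightarrow> ('m, real^'n) chart \<Rightarrow>
    real^'n \<Rightarrow> real^'n \<Rightarrow> real^'n \<Rightarrow> real^'n \<Rightarrow> real" where
  "dmet A g c x a v w =
     (\<Sum>i\<in>UNIV. \<Sum>j\<in>UNIV. frechet_derivative (metric_comp A g c i j) (at x) a * v $ i * w $ j)"

definition gam :: "('m, real^'n) chart set \<Rightarrow> ('m, real^'n) cov2 \<Rightarrow> ('m, real^'n) chart \<Rightarrow>
    real^'n \<Rightarrow> real^'n \<Rightarrow> real^'n \<Rightarrow> real^'n" where
  "gam A g c x y v =
     (\<chi> k. \<Sum>a\<in>UNIV. \<Sum>j\<in>UNIV. y $ a * christoffel A g c a j k x * v $ j)"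

lemma met_linear:
  "linear (\<lambda>v. met A g c x v w)" "linear (\<lambda>w. met A g c x v w)"
  by (rule linearI; simp add: met_def algebra_simps sum.distrib sum_distrib_left)+

lemma gam_linear: "linear (\<lambda>v. gam A g c x y v)"
  by (rule linearI; simp add: gam_def vec_eq_iff algebra_simps sum.distrib sum_distrib_left)

lemma sum3_rot:
  fixes f :: "'a \<Rightarrow> 'b \<Rightarrow> 'c \<Rightarrow> real"
  shows "(\<Sum>j\<in>J. \<Sum>l\<in>L. \<Sum>i\<in>I. f i j l) = (\<Sum>i\<in>I. \<Sum>j\<in>J. \<Sum>l\<in>L. f i j l)"
proof -
  have "(\<Sum>j\<in>J. \<Sum>l\<in>L. \<Sum>i\<in>I. f i j l) = (\<Sum>j\<in>J. \<Sum>i\<in>I. \<Sum>l\<in>L. f i j l)"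
    by (intro sum.cong refl sum.swap)
  also have "\<dots> = (\<Sum>i\<in>I. \<Sum>j\<in>J. \<Sum>l\<in>L. f i j l)" by (rule sum.swap)
  finally show ?thesis .
qed

locale riemannian_mfd =
  fixes X :: "'m topology" and A :: "('m, real^'n) chart set" and g :: "('m, real^'n) cov2"
  assumes M: "smooth_manifold X A" and R: "riemannian_metric A g"
begin

lemma nice: "nice_atlas A"
  by (rule manifold_nice[OF M])

lemma g_facts:
  assumes "c \<in> charts_at A p"
  shows "u \<in> tangent_space A p \<Longrightarrow> v \<in> tangent_space A p \<Longrightarrow> g p u v = g p v u"
    and "u \<in> tangent_space A p \<Longrightarrow> v \<in> tangent_space A p \<Longrightarrow> w \<in> tangent_space A p \<Longrightarrow>
           g p (\<lambda>c. a *\<^sub>R u c + b *\<^sub>R v c) w = a * g p u w + b * g p v w"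
    and "u \<in> tangent_space A p \<Longrightarrow> u \<noteq> (\<lambda>_. 0) \<Longrightarrow> g p u u > 0"
proof -
  have p: "p \<in> (\<Union>c\<in>A. fst c)" using assms by (auto simp: charts_at_def)
  note * = bspec[OF conjunct1[OF R[unfolded riemannian_metric_def]] p]
  show "u \<in> tangent_space A p \<Longrightarrow> v \<in> tangent_space A p \<Longrightarrow> g p u v = g p v u"
    using * by blast
  show "u \<in> tangent_space A p \<Longrightarrow> v \<in> tangent_space A p \<Longrightarrow> w \<in> tangent_space A p \<Longrightarrow>
           g p (\<lambda>c. a *\<^sub>R u c + b *\<^sub>R v c) w = a * g p u w + b * g p v w"
    using * by blast
  show "u \<in> tangent_space A p \<Longrightarrow> u \<noteq> (\<lambda>_. 0) \<Longrightarrow> g p u u > 0"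
    using * by blast
qed

lemma g_coord:
  assumes c: "c \<in> charts_at A p"
  shows "g p (coord_vec A c p v) (coord_vec A c p w) = met A g c (snd c p) v w"
proof -
  note mem = coord_vec_mem[OF nice c]
  have 1: "linear (\<lambda>v. g p (coord_vec A c p v) (coord_vec A c p w))" for w
  proof (rule linearI)
    fix x y show "g p (coord_vec A c p (x + y)) (coord_vec A c p w) =
       g p (coord_vec A c p x) (coord_vec A c p w) + g p (coord_vec A c p y) (coord_vec A c p w)"
      using coord_vec_lin[OF nice c, of 1 x 1 y] g_facts(2)[OF c mem mem mem, of 1 x 1 y w] by simp
  next
    fix r x show "g p (coord_vec A c p (r *\<^sub>R x)) (coord_vec A c p w) =
       r *\<^sub>R g p (coord_vec A c p x) (coord_vec A c p w)"
      using coord_vec_lin[OF nice c, of r x 0 x] g_facts(2)[OF c mem mem mem, of r x 0 x w] by simp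
  qed
  have 2: "linear (\<lambda>w. g p (coord_vec A c p v) (coord_vec A c p w))" for v
    using 1[of v] g_facts(1)[OF c mem mem] by simp
  have p: "chart_inv c (snd c p) = p"
    using chart_inv_eq[OF nice] c by (simp add: charts_at_def)
  have "g p (coord_vec A c p v) (coord_vec A c p w) =
    (\<Sum>i\<in>UNIV. v $ i *\<^sub>R (\<Sum>j\<in>UNIV. w $ j *\<^sub>R g p (coord_vec A c p (axis i 1)) (coord_vec A c p (axis j 1))))"
    by (subst linear_expand[OF 1], subst linear_expand[OF 2]) rule
  also have "\<dots> = met A g c (snd c p) v w"
    unfolding met_def metric_comp_def p by (simp add: sum_distrib_left mult_ac)
  finally show ?thesis .
qed

lemma met_sym:
  assumes "c \<in> charts_at A p"
  shows "met A g c (snd c p) v w = met A g c (snd c p) w v"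
  using g_facts(1)[OF assms coord_vec_mem[OF nice assms] coord_vec_mem[OF nice assms]]
  by (simp add: g_coord[OF assms])

lemma met_pos:
  assumes c: "c \<in> charts_at A p" and "v \<noteq> 0"
  shows "met A g c (snd c p) v v > 0"
proof -
  have "coord_vec A c p v \<noteq> (\<lambda>_. 0)"
    using coord_vec_self[OF nice c, of v] assms(2) by metis
  from g_facts(3)[OF c coord_vec_mem[OF nice c] this] show ?thesis by (simp add: g_coord[OF c])
qed

lemma met_change:
  assumes c: "c \<in> charts_at A p" and d: "d \<in> charts_at A p"
  shows "met A g d (snd d p) (jac c d p v) (jac c d p w) = met A g c (snd c p) v w"
  using g_coord[OF d] g_coord[OF c] coord_vec_change[OF nice c d] by metis

lemma met_nondeg:
  assumes c: "c \<in> charts_at A p" and eq: "\<And>w. met A g c (snd c p) u w = met A g c (snd c p) v w"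
  shows "u = v"
proof (rule ccontr)
  assume "u \<noteq> v"
  then have "met A g c (snd c p) (u - v) (u - v) > 0" using met_pos[OF c] by simp
  then show False using eq[of "u - v"] by (simp add: linear_diff[OF met_linear(1)])
qed

lemma comp_deriv:
  assumes c: "c \<in> charts_at A p"
  shows "(metric_comp A g c i j has_derivative frechet_derivative (metric_comp A g c i j) (at (snd c p)))
           (at (snd c p))"
proof -
  have "smooth_on (snd c ` fst c) (metric_comp A g c i j)"
    using c R unfolding riemannian_metric_def charts_at_def by blast
  then show ?thesis by (rule smooth_onD1) (use c in \<open>auto simp: charts_at_def\<close>)
qed

lemma met_deriv:
  assumes d: "d \<in> charts_at A p" and Fx: "F x = snd d p"
    and F: "(F has_derivative F') (at x)" and P: "(P has_derivative P') (at x)"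
    and Q: "(Q has_derivative Q') (at x)"
  shows "((\<lambda>z. met A g d (F z) (P z) (Q z)) has_derivative
           (\<lambda>a. dmet A g d (F x) (F' a) (P x) (Q x) + met A g d (F x) (P' a) (Q x) +
                met A g d (F x) (P x) (Q' a))) (at x)"
proof -
  have m: "((\<lambda>z. metric_comp A g d i j (F z)) has_derivative
      (\<lambda>a. frechet_derivative (metric_comp A g d i j) (at (F x)) (F' a))) (at x)" for i j
  proof -
    have "(metric_comp A g d i j has_derivative frechet_derivative (metric_comp A g d i j) (at (F x)))
       (at (F x))" unfolding Fx by (rule comp_deriv[OF d])
    from diff_chain_at[OF F this] show ?thesis by (simp only: o_def)
  qed
  have n: "((\<lambda>z. P z $ i) has_derivative (\<lambda>a. P' a $ i)) (at x)"
    "((\<lambda>z. Q z $ i) has_derivative (\<lambda>a. Q' a $ i)) (at x)" for i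
    by (rule bounded_linear.has_derivative[OF bounded_linear_vec_nth P]
        bounded_linear.has_derivative[OF bounded_linear_vec_nth Q])+
  have "((\<lambda>z. met A g d (F z) (P z) (Q z)) has_derivative
     (\<lambda>a. \<Sum>i\<in>UNIV. \<Sum>j\<in>UNIV. metric_comp A g d i j (F x) * P x $ i * Q' a $ j +
       (metric_comp A g d i j (F x) * P' a $ i +
        frechet_derivative (metric_comp A g d i j) (at (F x)) (F' a) * P x $ i) * Q x $ j)) (at x)"
    unfolding met_def by (intro has_derivative_sum has_derivative_mult m n)
  then show ?thesis
    by (rule has_derivative_eq_rhs)
      (simp add: fun_eq_iff met_def dmet_def sum.distrib[symmetric] algebra_simps)
qed

lemma koszul:
  assumes c: "c \<in> charts_at A p"
  defines "x \<equiv> snd c p"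
  shows "2 * met A g c x (gam A g c x y a) w =
           dmet A g c x y a w + dmet A g c x a y w - dmet A g c x w y a"
proof -
  define G where "G = (\<chi> i j. metric_comp A g c i j x)"
  define H where "H = matrix_inv G"
  define P where "P i j l = frechet_derivative (metric_comp A g c j l) (at x) (axis i 1)" for i j l
  define T where "T = (\<chi> l. \<Sum>i\<in>UNIV. \<Sum>j\<in>UNIV. y $ i * a $ j * (P i j l + P j i l - P l i j))"
  have met_G: "met A g c x v w = v \<bullet> (G *v w)" for v w
    by (simp add: met_def G_def inner_vec_def matrix_vector_mult_def sum_distrib_left mult_ac)
  have "\<exists>B. B ** G = mat 1"
    unfolding matrix_left_invertible_ker
  proof (intro allI impI)
    fix z assume "G *v z = 0"
    then have "met A g c x z z = 0" by (simp add: met_G)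
    then show "z = 0" using met_pos[OF c, of z] by (auto simp: x_def)
  qed
  then have "invertible G" by (simp add: invertible_left_inverse)
  then have GH: "G ** H = mat 1"
    unfolding H_def matrix_inv_def invertible_def by (rule someI2_ex) blast
  have "gam A g c x y a = (1/2) *\<^sub>R (H *v T)"
  proof (rule vec_eq_iff[THEN iffD2], rule allI)
    fix k
    have "gam A g c x y a $ k =
       (\<Sum>i\<in>UNIV. \<Sum>j\<in>UNIV. \<Sum>l\<in>UNIV. y $ i * a $ j * (P i j l + P j i l - P l i j) * H $ k $ l / 2)"
      by (simp add: gam_def christoffel_def Let_def P_def G_def H_def sum_distrib_left sum_distrib_right
          sum_divide_distrib mult_ac)
    also have "\<dots> = (\<Sum>l\<in>UNIV. \<Sum>i\<in>UNIV. \<Sum>j\<in>UNIV. y $ i * a $ j * (P i j l + P j i l - P l i j) * H $ k $ l / 2)"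
      by (rule sum3_rot)
    also have "\<dots> = ((1/2) *\<^sub>R (H *v T)) $ k"
      by (simp add: matrix_vector_mult_def T_def sum_distrib_left sum_divide_distrib mult_ac)
    finally show "gam A g c x y a $ k = ((1/2) *\<^sub>R (H *v T)) $ k" .
  qed
  then have "G *v gam A g c x y a = (1/2) *\<^sub>R T"
    by (simp add: matrix_vector_mult_scaleR matrix_vector_mul_assoc GH)
  then have "2 * met A g c x w (gam A g c x y a) = w \<bullet> T"
    by (simp add: met_G)
  also have "w \<bullet> T = (\<Sum>l\<in>UNIV. \<Sum>i\<in>UNIV. \<Sum>j\<in>UNIV. y $ i * a $ j * w $ l * (P i j l + P j i l - P l i j))"
    by (simp add: inner_vec_def T_def sum_distrib_left mult_ac)
  also have "\<dots> = (\<Sum>i\<in>UNIV. \<Sum>j\<in>UNIV. \<Sum>l\<in>UNIV. y $ i * a $ j * w $ l * (P i j l + P j i l - P l i j))"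
    by (rule sum3_rot[symmetric])
  also have "\<dots> = (\<Sum>i\<in>UNIV. \<Sum>j\<in>UNIV. \<Sum>l\<in>UNIV. y $ i * a $ j * w $ l * P i j l) +
      (\<Sum>i\<in>UNIV. \<Sum>j\<in>UNIV. \<Sum>l\<in>UNIV. y $ i * a $ j * w $ l * P j i l) -
      (\<Sum>i\<in>UNIV. \<Sum>j\<in>UNIV. \<Sum>l\<in>UNIV. y $ i * a $ j * w $ l * P l i j)"
    by (simp add: algebra_simps sum.distrib sum_subtractf)
  finally have *: "2 * met A g c x w (gam A g c x y a) =
      (\<Sum>i\<in>UNIV. \<Sum>j\<in>UNIV. \<Sum>l\<in>UNIV. y $ i * a $ j * w $ l * P i j l) +
      (\<Sum>i\<in>UNIV. \<Sum>j\<in>UNIV. \<Sum>l\<in>UNIV. y $ i * a $ j * w $ l * P j i l) -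
      (\<Sum>i\<in>UNIV. \<Sum>j\<in>UNIV. \<Sum>l\<in>UNIV. y $ i * a $ j * w $ l * P l i j)" .
  have dm: "dmet A g c x u v w = (\<Sum>j\<in>UNIV. \<Sum>l\<in>UNIV. \<Sum>i\<in>UNIV. u $ i * v $ j * w $ l * P i j l)" for u v w
  proof -
    have "frechet_derivative (metric_comp A g c j l) (at x) u = (\<Sum>i\<in>UNIV. u $ i * P i j l)" for j l
      using linear_expand[OF has_derivative_linear[OF comp_deriv[OF c]], of j l u]
      by (simp add: P_def x_def)
    then show ?thesis by (simp add: dmet_def sum_distrib_left sum_distrib_right mult_ac)
  qed
  have 1: "dmet A g c x y a w = (\<Sum>i\<in>UNIV. \<Sum>j\<in>UNIV. \<Sum>l\<in>UNIV. y $ i * a $ j * w $ l * P i j l)"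
    unfolding dm by (rule sum3_rot)
  have 2: "dmet A g c x a y w = (\<Sum>i\<in>UNIV. \<Sum>j\<in>UNIV. \<Sum>l\<in>UNIV. y $ i * a $ j * w $ l * P j i l)"
    unfolding dm by (subst (3) sum.swap) (simp add: mult_ac)
  have 3: "dmet A g c x w y a = (\<Sum>i\<in>UNIV. \<Sum>j\<in>UNIV. \<Sum>l\<in>UNIV. y $ i * a $ j * w $ l * P l i j)"
    unfolding dm by (simp add: mult_ac)
  show ?thesis
    unfolding 1 2 3 using * met_sym[OF c, of w "gam A g c x y a"] by (simp add: x_def)
qed

definition hess :: "('m, real^'n) chart \<Rightarrow> ('m, real^'n) chart \<Rightarrow> 'm \<Rightarrow> real^'n \<Rightarrow> real^'n \<Rightarrow> real^'n" where
  "hess c d p v = frechet_derivative (\<lambda>z. frechet_derivative (transition c d) (at z) v) (at (snd c p))"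

lemma overlap:
  assumes "c \<in> charts_at A p" "d \<in> charts_at A p"
  shows "open (snd c ` (fst c \<inter> fst d))" "snd c p \<in> snd c ` (fst c \<inter> fst d)"
    "smooth_on (snd c ` (fst c \<inter> fst d)) (transition c d)"
  using assms manifold_overlap_open[OF M] manifoldD(4)[OF M] by (simp_all add: charts_at_def)

lemma hess_deriv:
  assumes "c \<in> charts_at A p" "d \<in> charts_at A p"
  shows "((\<lambda>z. frechet_derivative (transition c d) (at z) v) has_derivative hess c d p v) (at (snd c p))"
  unfolding hess_def by (rule smooth_onD1[OF smooth_onD2[OF overlap(3)[OF assms]] overlap(2)[OF assms]])

lemma hess_sym:
  assumes "c \<in> charts_at A p" "d \<in> charts_at A p"
  shows "hess c d p v w = hess c d p w v"
  unfolding hess_def by (rule second_derivative_symmetric[OF overlap[OF assms]])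

lemma dmet_change:
  assumes c: "c \<in> charts_at A p" and d: "d \<in> charts_at A p"
  shows "dmet A g c (snd c p) a v w =
     dmet A g d (snd d p) (jac c d p a) (jac c d p v) (jac c d p w) +
     met A g d (snd d p) (hess c d p v a) (jac c d p w) +
     met A g d (snd d p) (jac c d p v) (hess c d p w a)"
proof -
  let ?F = "transition c d" and ?x = "snd c p"
  let ?P = "\<lambda>v z. frechet_derivative ?F (at z) v"
  have Fx: "?F ?x = snd d p" using transition_eq[OF nice] c by (simp add: charts_at_def)
  have 1: "((\<lambda>z. met A g d (?F z) (?P v z) (?P w z)) has_derivative
     (\<lambda>a. dmet A g d (?F ?x) (jac c d p a) (?P v ?x) (?P w ?x) +
        met A g d (?F ?x) (hess c d p v a) (?P w ?x) + met A g d (?F ?x) (?P v ?x) (hess c d p w a)))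
     (at ?x)"
    by (rule met_deriv[OF d Fx jac_deriv[OF nice c d] hess_deriv[OF c d] hess_deriv[OF c d]])
  have 2: "((\<lambda>z. met A g c z v w) has_derivative
     (\<lambda>a. dmet A g d (?F ?x) (jac c d p a) (?P v ?x) (?P w ?x) +
        met A g d (?F ?x) (hess c d p v a) (?P w ?x) + met A g d (?F ?x) (?P v ?x) (hess c d p w a)))
     (at ?x)"
  proof (rule has_derivative_transform_within_open[OF 1 overlap(1,2)[OF c d]])
    fix z assume "z \<in> snd c ` (fst c \<inter> fst d)"
    then obtain q where q: "q \<in> fst c" "q \<in> fst d" "z = snd c q" by auto
    then have cd: "c \<in> charts_at A q" "d \<in> charts_at A q" using c d by (auto simp: charts_at_def)
    have "?F z = snd d q" using transition_eq[OF nice] c q by (simp add: charts_at_def)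
    then show "met A g d (?F z) (?P v z) (?P w z) = met A g c z v w"
      using met_change[OF cd] q by (simp add: jac_def)
  qed
  have 3: "((\<lambda>z. met A g c z v w) has_derivative (\<lambda>a. dmet A g c ?x a v w)) (at ?x)"
  proof -
    have "((\<lambda>z. met A g c z v w) has_derivative
       (\<lambda>a. dmet A g c ?x a v w + met A g c ?x 0 w + met A g c ?x v 0)) (at ?x)"
      by (rule met_deriv[OF c refl has_derivative_ident has_derivative_const has_derivative_const])
    moreover have "met A g c ?x 0 w = 0" "met A g c ?x v 0 = 0" by (simp_all add: met_def)
    ultimately show ?thesis by simp
  qed
  from fun_cong[OF has_derivative_unique[OF 3 2], of a] show ?thesis
    by (simp add: Fx jac_def)
qed

lemma jac_inverse:
  assumes "c \<in> charts_at A p" "d \<in> charts_at A p"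
  shows "jac c d p (jac d c p v) = v"
  using jac_chain[OF nice assms(2,1,2)] jac_self[OF nice assms(2)] by simp

lemma gam_change:
  assumes c: "c \<in> charts_at A p" and d: "d \<in> charts_at A p"
  shows "jac c d p (gam A g c (snd c p) y a) =
     gam A g d (snd d p) (jac c d p y) (jac c d p a) + hess c d p y a"
proof (rule met_nondeg[OF d])
  fix w'
  define w where "w = jac d c p w'"
  have w': "w' = jac c d p w" by (simp add: w_def jac_inverse[OF c d])
  let ?B = "met A g d (snd d p)" and ?J = "jac c d p" and ?H = "hess c d p"
  have "2 * ?B (?J (gam A g c (snd c p) y a)) (?J w) =
     dmet A g c (snd c p) y a w + dmet A g c (snd c p) a y w - dmet A g c (snd c p) w y a"
    by (simp add: met_change[OF c d] koszul[OF c])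
  also have "\<dots> = dmet A g d (snd d p) (?J y) (?J a) (?J w) + dmet A g d (snd d p) (?J a) (?J y) (?J w)
      - dmet A g d (snd d p) (?J w) (?J y) (?J a) + 2 * ?B (?H y a) (?J w)"
    using hess_sym[OF c d, of a y] hess_sym[OF c d, of w y] hess_sym[OF c d, of w a]
      met_sym[OF d, of "?J a" "?H w y"] met_sym[OF d, of "?J a" "?H y w"]
    by (simp add: dmet_change[OF c d])
  also have "\<dots> = 2 * ?B (gam A g d (snd d p) (?J y) (?J a)) (?J w) + 2 * ?B (?H y a) (?J w)"
    by (simp add: koszul[OF d])
  finally show "?B (?J (gam A g c (snd c p) y a)) w' =
      ?B (gam A g d (snd d p) (?J y) (?J a) + ?H y a) w'"
    by (simp add: w' linear_add[OF met_linear(1)])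
qed

subsection \<open>Charts of the slit tangent bundle\<close>

lemma slitD:
  assumes "u \<in> slit_tangent_bundle A"
  shows "snd u \<in> tangent_space A (fst u)" "snd u \<noteq> (\<lambda>_. 0)"
  using assms by (auto simp: slit_tangent_bundle_def)

lemma slit_comp_nonzero:
  assumes u: "u \<in> slit_tangent_bundle A" and c: "c \<in> charts_at A (fst u)"
  shows "snd u c \<noteq> 0"
proof
  assume "snd u c = 0"
  with tangent_eq_coord[OF nice c slitD(1)[OF u]] have "snd u = coord_vec A c (fst u) 0" by simp
  then show False using coord_vec_zero[OF nice c] slitD(2)[OF u] by simp
qed

lemma lift_overlap:
  assumes c: "c \<in> A" and d: "d \<in> A"
  shows "snd (lift_chart A c) ` (fst (lift_chart A c) \<inter> fst (lift_chart A d)) =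
     (snd c ` (fst c \<inter> fst d)) \<times> (- {0})" (is "?L = ?R")
proof
  show "?L \<subseteq> ?R"
  proof
    fix z assume "z \<in> ?L"
    then obtain u where u: "u \<in> slit_tangent_bundle A" "fst u \<in> fst c" "fst u \<in> fst d"
      "z = (snd c (fst u), snd u c)" by (auto simp: lift_chart_def)
    then show "z \<in> ?R" using slit_comp_nonzero[OF u(1)] c by (auto simp: charts_at_def)
  qed
  show "?R \<subseteq> ?L"
  proof
    fix z assume "z \<in> ?R"
    then obtain q y where q: "q \<in> fst c" "q \<in> fst d" "z = (snd c q, y)" "y \<noteq> 0" by auto
    have cq: "c \<in> charts_at A q" using c q by (simp add: charts_at_def)
    let ?u = "(q, coord_vec A c q y)"
    have e: "coord_vec A c q y c = y" by (rule coord_vec_self[OF nice cq])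
    have ne: "coord_vec A c q y \<noteq> (\<lambda>_. 0)" using q(4) by (subst fun_eq_iff) (metis e)
    then have "?u \<in> slit_tangent_bundle A"
      using coord_vec_mem[OF nice cq] c q by (auto simp: slit_tangent_bundle_def)
    then have "?u \<in> fst (lift_chart A c) \<inter> fst (lift_chart A d)" using q by (simp add: lift_chart_def)
    moreover have "z = snd (lift_chart A c) ?u" using q e by (simp add: lift_chart_def)
    ultimately show "z \<in> ?L" by (rule rev_image_eqI)
  qed
qed

lemma lift_inj:
  assumes c: "c \<in> A"
  shows "inj_on (snd (lift_chart A c)) (fst (lift_chart A c))"
proof (rule inj_onI)
  fix u u' assume u: "u \<in> fst (lift_chart A c)" and u': "u' \<in> fst (lift_chart A c)"
    and eq: "snd (lift_chart A c) u = snd (lift_chart A c) u'"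
  have m: "u \<in> slit_tangent_bundle A" "u' \<in> slit_tangent_bundle A" "fst u \<in> fst c" "fst u' \<in> fst c"
    using u u' by (auto simp: lift_chart_def)
  have e: "snd c (fst u) = snd c (fst u')" "snd u c = snd u' c" using eq by (simp_all add: lift_chart_def)
  have p: "fst u = fst u'"
    using chart_inv_eq[OF nice c m(3)] chart_inv_eq[OF nice c m(4)] e(1) by metis
  have "c \<in> charts_at A (fst u)" using c m by (simp add: charts_at_def)
  moreover have "snd u' \<in> tangent_space A (fst u)" using slitD(1)[OF m(2)] p by simp
  ultimately have "snd u = snd u'"
    using tangent_eqI[OF nice] slitD(1)[OF m(1)] e(2) by blast
  with p show "u = u'" by (rule prod_eqI)
qed

lemma lift_transition:
  assumes c: "c \<in> A" and d: "d \<in> A"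
    and z: "z \<in> snd (lift_chart A c) ` (fst (lift_chart A c) \<inter> fst (lift_chart A d))"
  shows "transition (lift_chart A c) (lift_chart A d) z =
     (transition c d (fst z), frechet_derivative (transition c d) (at (fst z)) (snd z))"
proof -
  obtain u where u: "u \<in> fst (lift_chart A c)" "u \<in> fst (lift_chart A d)" "z = snd (lift_chart A c) u"
    using z by auto
  have m: "u \<in> slit_tangent_bundle A" "fst u \<in> fst c" "fst u \<in> fst d" using u by (auto simp: lift_chart_def)
  have "chart_inv (lift_chart A c) z = u"
    using inv_into_f_f[OF lift_inj[OF c] u(1)] u(3) by (simp add: chart_inv_def)
  then have "transition (lift_chart A c) (lift_chart A d) z = (snd d (fst u), snd u d)"
    by (simp add: transition_def lift_chart_def)
  moreover have "snd u d = jac c d (fst u) (snd u c)"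
    by (rule tangent_jac[OF slitD(1)[OF m(1)]]) (use c d m in \<open>simp_all add: charts_at_def\<close>)
  moreover have "fst z = snd c (fst u)" "snd z = snd u c" using u(3) by (simp_all add: lift_chart_def)
  ultimately show ?thesis using transition_eq[OF nice c m(2)] by (simp add: jac_def)
qed

lemma lift_deriv:
  assumes c: "c \<in> charts_at A p" and d: "d \<in> charts_at A p" and y: "y \<noteq> 0"
  shows "(transition (lift_chart A c) (lift_chart A d) has_derivative
     (\<lambda>h. (jac c d p (fst h), hess c d p y (fst h) + jac c d p (snd h)))) (at (snd c p, y))"
proof -
  let ?S = "snd c ` (fst c \<inter> fst d)" and ?F = "transition c d" and ?x = "snd c p"
  let ?D = "\<lambda>z v. frechet_derivative ?F (at z) v"
  have cA: "c \<in> A" and dA: "d \<in> A" using c d by (simp_all add: charts_at_def)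
  have lin: "?D z v = (\<Sum>i\<in>UNIV. v $ i *\<^sub>R ?D z (axis i 1))" if "z \<in> ?S" for z v
    by (rule linear_expand[OF has_derivative_linear[OF smooth_onD1[OF overlap(3)[OF c d] that]]])
  have hl: "linear (\<lambda>v. hess c d p v a)" for a
    unfolding hess_sym[OF c d, of _ a] by (rule has_derivative_linear[OF hess_deriv[OF c d]])
  have fs: "(fst has_derivative fst) (at (?x, y))" "(snd has_derivative snd) (at (?x, y))"
    by (rule bounded_linear.has_derivative[OF bounded_linear_fst has_derivative_ident]
        bounded_linear.has_derivative[OF bounded_linear_snd has_derivative_ident])+
  have 1: "((\<lambda>z. ?F (fst z)) has_derivative (\<lambda>h. jac c d p (fst h))) (at (?x, y))"
    using diff_chain_at[OF fs(1), of ?F "jac c d p"] jac_deriv[OF nice c d] by (simp add: o_def)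
  have 2: "((\<lambda>z. ?D (fst z) v) has_derivative (\<lambda>h. hess c d p v (fst h))) (at (?x, y))" for v
    using diff_chain_at[OF fs(1), of "\<lambda>z. ?D z v" "hess c d p v"] hess_deriv[OF c d] by (simp add: o_def)
  have 3: "((\<lambda>z. snd z $ i) has_derivative (\<lambda>h. snd h $ i)) (at (?x, y))" for i
    by (rule bounded_linear.has_derivative[OF bounded_linear_vec_nth fs(2)])
  have 4: "((\<lambda>z. \<Sum>i\<in>UNIV. snd z $ i *\<^sub>R ?D (fst z) (axis i 1)) has_derivative
     (\<lambda>h. \<Sum>i\<in>UNIV. y $ i *\<^sub>R hess c d p (axis i 1) (fst h) + snd h $ i *\<^sub>R ?D ?x (axis i 1))) (at (?x, y))"
    by (rule has_derivative_eq_rhs[OF has_derivative_sum[OF has_derivative_scaleR[OF 3 2]]]) simp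
  have 5: "(\<Sum>i\<in>UNIV. y $ i *\<^sub>R hess c d p (axis i 1) a + b $ i *\<^sub>R ?D ?x (axis i 1)) =
      hess c d p y a + jac c d p b" for a b
    using linear_expand[OF hl, of y a] lin[OF overlap(2)[OF c d], of b]
    by (simp add: sum.distrib jac_def)
  have 6: "((\<lambda>z. (?F (fst z), \<Sum>i\<in>UNIV. snd z $ i *\<^sub>R ?D (fst z) (axis i 1))) has_derivative
     (\<lambda>h. (jac c d p (fst h), hess c d p y (fst h) + jac c d p (snd h)))) (at (?x, y))"
    using has_derivative_Pair[OF 1 4] by (simp only: 5)
  show ?thesis
  proof (rule has_derivative_transform_within_open[OF 6])
    show "open (?S \<times> (- {0::real^'n}))" by (intro open_Times overlap(1)[OF c d]) auto
    show "(?x, y) \<in> ?S \<times> (- {0})" using overlap(2)[OF c d] y by auto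
    fix z assume z: "z \<in> ?S \<times> (- {0::real^'n})"
    then have "fst z \<in> ?S" by auto
    with lift_transition[OF cA dA, of z] z lift_overlap[OF cA dA]
    show "(?F (fst z), \<Sum>i\<in>UNIV. snd z $ i *\<^sub>R ?D (fst z) (axis i 1)) =
        transition (lift_chart A c) (lift_chart A d) z"
      using lin[of "fst z" "snd z"] by simp
  qed
qed

lemma lift_nice: "nice_atlas (lift_atlas A)"
  unfolding nice_atlas_def lift_atlas_def ball_simps
proof (intro conjI ballI)
  fix c assume "c \<in> A" then show "inj_on (snd (lift_chart A c)) (fst (lift_chart A c))" by (rule lift_inj)
next
  fix c d assume "c \<in> A" "d \<in> A"
  then show "open (snd (lift_chart A c) ` (fst (lift_chart A c) \<inter> fst (lift_chart A d)))"
    unfolding lift_overlap[OF \<open>c \<in> A\<close> \<open>d \<in> A\<close>] by (intro open_Times manifold_overlap_open[OF M]) auto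
next
  fix c d u assume cd: "c \<in> A" "d \<in> A" and u: "u \<in> fst (lift_chart A c) \<inter> fst (lift_chart A d)"
  then have m: "u \<in> slit_tangent_bundle A" "c \<in> charts_at A (fst u)" "d \<in> charts_at A (fst u)"
    by (auto simp: lift_chart_def charts_at_def)
  have "snd (lift_chart A c) u = (snd c (fst u), snd u c)" by (simp add: lift_chart_def)
  then show "transition (lift_chart A c) (lift_chart A d) differentiable (at (snd (lift_chart A c) u))"
    using lift_deriv[OF m(2,3) slit_comp_nonzero[OF m(1,2)]] unfolding differentiable_def by metis
qed

lemma lift_charts_at:
  assumes "u \<in> slit_tangent_bundle A" "c \<in> charts_at A (fst u)"
  shows "lift_chart A c \<in> charts_at (lift_atlas A) u"
  using assms by (auto simp: charts_at_def lift_atlas_def lift_chart_def)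

lemma lift_jac:
  assumes u: "u \<in> slit_tangent_bundle A" and c: "c \<in> charts_at A (fst u)" and d: "d \<in> charts_at A (fst u)"
  shows "jac (lift_chart A c) (lift_chart A d) u h =
     (jac c d (fst u) (fst h), hess c d (fst u) (snd u c) (fst h) + jac c d (fst u) (snd h))"
proof -
  have "snd (lift_chart A c) u = (snd c (fst u), snd u c)" by (simp add: lift_chart_def)
  with fun_cong[OF frechet_derivative_at[OF lift_deriv[OF c d slit_comp_nonzero[OF u c]]], of h]
  show ?thesis by (simp only: jac_def[of "lift_chart A c"])
qed

subsection \<open>The coframe, the metric and the tensor of type (1,1) in different charts\<close>

definition DX :: "('m, real^'n) chart \<Rightarrow> ('m, 'n) tm_vec \<Rightarrow> real^'n" where
  "DX c \<xi> = (\<chi> i. dx A c i \<xi>)"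

definition DY :: "('m, real^'n) chart \<Rightarrow> ('m, 'n) tm_point \<Rightarrow> ('m, 'n) tm_vec \<Rightarrow> real^'n" where
  "DY c u \<xi> = (\<chi> i. \<delta>y A g c i u \<xi>)"

lemma DX_eq: "DX c \<xi> = fst (\<xi> (lift_chart A c))"
  by (simp add: DX_def dx_def vec_eq_iff)

lemma DY_eq: "DY c u \<xi> = snd (\<xi> (lift_chart A c)) + gam A g c (snd c (fst u)) (snd u c) (DX c \<xi>)"
  by (simp add: DY_def \<delta>y_def gam_def vec_eq_iff DX_def)

lemma coframe_change:
  assumes u: "u \<in> slit_tangent_bundle A" and c: "c \<in> charts_at A (fst u)" and d: "d \<in> charts_at A (fst u)"
    and xi: "\<xi> \<in> tangent_space (lift_atlas A) u"
  shows "DX d \<xi> = jac c d (fst u) (DX c \<xi>)" "DY d u \<xi> = jac c d (fst u) (DY c u \<xi>)"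
proof -
  have e: "\<xi> (lift_chart A d) = jac (lift_chart A c) (lift_chart A d) u (\<xi> (lift_chart A c))"
    by (rule tangent_jac[OF xi lift_charts_at[OF u c] lift_charts_at[OF u d]])
  show 1: "DX d \<xi> = jac c d (fst u) (DX c \<xi>)"
    unfolding DX_eq e lift_jac[OF u c d] by simp
  have y: "snd u d = jac c d (fst u) (snd u c)" by (rule tangent_jac[OF slitD(1)[OF u] c d])
  have s: "snd (\<xi> (lift_chart A d)) = hess c d (fst u) (snd u c) (DX c \<xi>) +
      jac c d (fst u) (snd (\<xi> (lift_chart A c)))"
    unfolding e lift_jac[OF u c d] by (simp add: DX_eq)
  show "DY d u \<xi> = jac c d (fst u) (DY c u \<xi>)"
    unfolding DY_eq[of d] s 1 y
    by (simp add: DY_eq linear_add[OF jac_linear[OF nice c d]] gam_change[OF c d])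
qed

lemma tangent_eqI_coframe:
  assumes u: "u \<in> slit_tangent_bundle A" and c: "c \<in> charts_at A (fst u)"
    and t: "\<xi> \<in> tangent_space (lift_atlas A) u" "\<eta> \<in> tangent_space (lift_atlas A) u"
    and e: "DX c \<xi> = DX c \<eta>" "DY c u \<xi> = DY c u \<eta>"
  shows "\<xi> = \<eta>"
proof (rule tangent_eqI[OF lift_nice lift_charts_at[OF u c] t])
  show "\<xi> (lift_chart A c) = \<eta> (lift_chart A c)"
    using e by (simp add: DY_eq) (simp add: DX_eq prod_eq_iff)
qed

lemma norm_eq: "fibre_norm A g c u = sqrt (met A g c (snd c (fst u)) (snd u c) (snd u c))"
  by (simp add: fibre_norm_def met_def)

lemma norm_pos:
  assumes u: "u \<in> slit_tangent_bundle A" and c: "c \<in> charts_at A (fst u)"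
  shows "fibre_norm A g c u > 0"
  using met_pos[OF c slit_comp_nonzero[OF u c]] by (simp add: norm_eq)

lemma norm_change:
  assumes u: "u \<in> slit_tangent_bundle A" and c: "c \<in> charts_at A (fst u)" and d: "d \<in> charts_at A (fst u)"
  shows "fibre_norm A g d u = fibre_norm A g c u"
  using met_change[OF c d] tangent_jac[OF slitD(1)[OF u] c d] by (simp add: norm_eq)

lemma g2_chart_eq:
  "g2_chart A g c u \<xi> \<eta> = 2 / fibre_norm A g c u *
     (met A g c (snd c (fst u)) (DX c \<xi>) (DY c u \<eta>) + met A g c (snd c (fst u)) (DX c \<eta>) (DY c u \<xi>))"
  by (simp add: g2_chart_def met_def DX_def DY_def algebra_simps sum.distrib)

lemma horizontal_eq:
  assumes u: "u \<in> slit_tangent_bundle A" and c: "c \<in> charts_at A (fst u)"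
  shows "horizontal A g c i u = coord_vec (lift_atlas A) (lift_chart A c) u
     (axis i 1, - gam A g c (snd c (fst u)) (snd u c) (axis i 1))"
proof
  fix d
  define L where "L e = coord_vec (lift_atlas A) (lift_chart A c) u e d" for e
  have L: "linear L"
    unfolding L_def[abs_def] by (rule coord_vec_linear[OF lift_nice lift_charts_at[OF u c]])
  let ?s = "\<lambda>a m. snd u c $ a * christoffel A g c a i m (snd c (fst u))"
  have "(\<Sum>a\<in>UNIV. \<Sum>m\<in>UNIV. ?s a m *\<^sub>R L (0, axis m 1)) =
      L (\<Sum>a\<in>UNIV. \<Sum>m\<in>UNIV. ?s a m *\<^sub>R (0, axis m 1))"
    by (simp only: linear_sum[OF L] linear_scale[OF L])
  also have "(\<Sum>a\<in>UNIV. \<Sum>m\<in>UNIV. ?s a m *\<^sub>R (0::real^'n, axis m 1 :: real^'n)) =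
      (0, gam A g c (snd c (fst u)) (snd u c) (axis i 1))"
    by (simp add: prod_eq_iff fst_sum snd_sum vec_eq_iff gam_def axis_def if_distrib cong: if_cong)
  finally show "horizontal A g c i u d = coord_vec (lift_atlas A) (lift_chart A c) u
     (axis i 1, - gam A g c (snd c (fst u)) (snd u c) (axis i 1)) d"
    using linear_diff[OF L, of "(axis i 1, 0)" "(0, gam A g c (snd c (fst u)) (snd u c) (axis i 1))"]
    by (simp add: horizontal_def vertical_def L_def)
qed

lemma Q_chart_eq:
  assumes u: "u \<in> slit_tangent_bundle A" and c: "c \<in> charts_at A (fst u)"
  shows "Q_chart A g c u \<xi> = coord_vec (lift_atlas A) (lift_chart A c) u
     ((1 / fibre_norm A g c u) *\<^sub>R DY c u \<xi>, fibre_norm A g c u *\<^sub>R DX c \<xi> -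
       gam A g c (snd c (fst u)) (snd u c) ((1 / fibre_norm A g c u) *\<^sub>R DY c u \<xi>))"
proof
  fix d
  define L where "L e = coord_vec (lift_atlas A) (lift_chart A c) u e d" for e
  have L: "linear L"
    unfolding L_def[abs_def] by (rule coord_vec_linear[OF lift_nice lift_charts_at[OF u c]])
  let ?N = "fibre_norm A g c u" and ?G = "gam A g c (snd c (fst u)) (snd u c)"
  have "Q_chart A g c u \<xi> d = (\<Sum>i\<in>UNIV. (DX c \<xi> $ i * ?N) *\<^sub>R L (0, axis i 1) +
      (DY c u \<xi> $ i * (1 / ?N)) *\<^sub>R L (axis i 1, - ?G (axis i 1)))"
    by (simp add: Q_chart_def horizontal_eq[OF u c] vertical_def L_def DX_def DY_def)
  also have "\<dots> = L (\<Sum>i\<in>UNIV. (DX c \<xi> $ i * ?N) *\<^sub>R (0, axis i 1) +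
      (DY c u \<xi> $ i * (1 / ?N)) *\<^sub>R (axis i 1, - ?G (axis i 1)))"
    by (simp only: linear_sum[OF L] linear_scale[OF L] linear_add[OF L])
  also have "(\<Sum>i\<in>UNIV. (DX c \<xi> $ i * ?N) *\<^sub>R (0, axis i 1) +
      (DY c u \<xi> $ i * (1 / ?N)) *\<^sub>R (axis i 1, - ?G (axis i 1))) =
      ((1 / ?N) *\<^sub>R DY c u \<xi>, ?N *\<^sub>R DX c \<xi> - ?G ((1 / ?N) *\<^sub>R DY c u \<xi>))"
  proof -
    have 1: "(\<Sum>i\<in>UNIV. (v $ i * r) *\<^sub>R f (axis i 1)) = r *\<^sub>R f v"
      if "linear f" for f :: "real^'n \<Rightarrow> real^'n" and v r
      by (subst (2) linear_expand[OF that]) (simp add: scaleR_sum_right mult.commute)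
    have 2: "(\<Sum>i\<in>UNIV. (v $ i * r) *\<^sub>R axis i 1) = r *\<^sub>R v" for v :: "real^'n" and r
      using 1[OF linear_id] by simp
    show ?thesis
      using 1[OF gam_linear, of "DY c u \<xi>" "1 / ?N" A g c "snd c (fst u)" "snd u c"]
        2[of "DY c u \<xi>" "1 / ?N"] 2[of "DX c \<xi>" ?N]
      by (simp add: prod_eq_iff fst_sum snd_sum sum_subtractf linear_scale[OF gam_linear])
  qed
  finally show "Q_chart A g c u \<xi> d = coord_vec (lift_atlas A) (lift_chart A c) u
     ((1 / ?N) *\<^sub>R DY c u \<xi>, ?N *\<^sub>R DX c \<xi> - ?G ((1 / ?N) *\<^sub>R DY c u \<xi>)) d"
    by (simp add: L_def)
qed

lemma coframe_coord:
  assumes u: "u \<in> slit_tangent_bundle A" and c: "c \<in> charts_at A (fst u)"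
  shows "DX c (coord_vec (lift_atlas A) (lift_chart A c) u (a, b)) = a"
    "DY c u (coord_vec (lift_atlas A) (lift_chart A c) u (a, b)) =
       b + gam A g c (snd c (fst u)) (snd u c) a"
  using coord_vec_self[OF lift_nice lift_charts_at[OF u c], of "(a, b)"] by (simp_all add: DX_eq DY_eq)

lemma Q_chart_mem:
  assumes "u \<in> slit_tangent_bundle A" "c \<in> charts_at A (fst u)"
  shows "Q_chart A g c u \<xi> \<in> tangent_space (lift_atlas A) u"
  unfolding Q_chart_eq[OF assms] by (rule coord_vec_mem[OF lift_nice lift_charts_at[OF assms]])

lemma coframe_Q:
  assumes u: "u \<in> slit_tangent_bundle A" and c: "c \<in> charts_at A (fst u)"
  shows "DX c (Q_chart A g c u \<xi>) = (1 / fibre_norm A g c u) *\<^sub>R DY c u \<xi>"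
    "DY c u (Q_chart A g c u \<xi>) = fibre_norm A g c u *\<^sub>R DX c \<xi>"
  unfolding Q_chart_eq[OF u c] coframe_coord[OF u c] by simp_all

lemma coframe_frame:
  assumes u: "u \<in> slit_tangent_bundle A" and c: "c \<in> charts_at A (fst u)"
  shows "DX c (horizontal A g c i u) = axis i 1" "DY c u (horizontal A g c i u) = 0"
    "DX c (vertical A c i u) = 0" "DY c u (vertical A c i u) = axis i 1"
  unfolding horizontal_eq[OF u c] vertical_def coframe_coord[OF u c]
  by (simp_all add: linear_0[OF gam_linear])

lemma g2_chart_change:
  assumes u: "u \<in> slit_tangent_bundle A" and c: "c \<in> charts_at A (fst u)" and d: "d \<in> charts_at A (fst u)"
    and t: "\<xi> \<in> tangent_space (lift_atlas A) u" "\<eta> \<in> tangent_space (lift_atlas A) u"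
  shows "g2_chart A g d u \<xi> \<eta> = g2_chart A g c u \<xi> \<eta>"
  by (simp add: g2_chart_eq coframe_change[OF u c d t(1)] coframe_change[OF u c d t(2)]
      met_change[OF c d] norm_change[OF u c d])

lemma Q_chart_change:
  assumes u: "u \<in> slit_tangent_bundle A" and c: "c \<in> charts_at A (fst u)" and d: "d \<in> charts_at A (fst u)"
    and t: "\<xi> \<in> tangent_space (lift_atlas A) u"
  shows "Q_chart A g d u \<xi> = Q_chart A g c u \<xi>"
  by (rule tangent_eqI_coframe[OF u d Q_chart_mem[OF u d] Q_chart_mem[OF u c]])
    (simp_all add: coframe_change[OF u c d Q_chart_mem[OF u c]] coframe_Q[OF u c] coframe_Q[OF u d]
      coframe_change[OF u c d t] norm_change[OF u c d] linear_scale[OF jac_linear[OF nice c d]])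

lemma some_chart_mem:
  assumes "u \<in> slit_tangent_bundle A"
  shows "some_chart A (fst u) \<in> charts_at A (fst u)"
proof -
  have "\<exists>c. c \<in> charts_at A (fst u)" using assms by (auto simp: slit_tangent_bundle_def charts_at_def)
  then show ?thesis unfolding some_chart_def by (rule someI_ex)
qed

theorem g2_tilde_chart:
  assumes "u \<in> slit_tangent_bundle A" "c \<in> charts_at A (fst u)"
    "\<xi> \<in> tangent_space (lift_atlas A) u" "\<eta> \<in> tangent_space (lift_atlas A) u"
  shows "g2_tilde A g u \<xi> \<eta> = g2_chart A g c u \<xi> \<eta>"
  unfolding g2_tilde_def by (rule g2_chart_change[OF assms(1,2) some_chart_mem[OF assms(1)] assms(3,4)])

theorem Q_tilde_chart:
  assumes "u \<in> slit_tangent_bundle A" "c \<in> charts_at A (fst u)"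
    "\<xi> \<in> tangent_space (lift_atlas A) u"
  shows "Q_tilde A g u \<xi> = Q_chart A g c u \<xi>"
  unfolding Q_tilde_def by (rule Q_chart_change[OF assms(1,2) some_chart_mem[OF assms(1)] assms(3)])

theorem Q_tilde_mem:
  assumes "u \<in> slit_tangent_bundle A"
  shows "Q_tilde A g u \<xi> \<in> tangent_space (lift_atlas A) u"
  unfolding Q_tilde_def by (rule Q_chart_mem[OF assms some_chart_mem[OF assms]])

lemma frame_mem:
  assumes "u \<in> slit_tangent_bundle A" "c \<in> charts_at A (fst u)"
  shows "horizontal A g c i u \<in> tangent_space (lift_atlas A) u"
    "vertical A c i u \<in> tangent_space (lift_atlas A) u"
  unfolding horizontal_eq[OF assms] vertical_def
  by (rule coord_vec_mem[OF lift_nice lift_charts_at[OF assms]])+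

lemma met_axis: "met A g c x (axis i 1) (axis j 1) = metric_comp A g c i j x"
proof -
  have "metric_comp A g c k l x * axis i 1 $ k * axis j 1 $ l =
      (if l = j then (if k = i then metric_comp A g c k l x else 0) else 0)" for k l
    by (simp add: axis_def)
  then have "met A g c x (axis i 1) (axis j 1) =
      (\<Sum>k\<in>UNIV. \<Sum>l\<in>UNIV. if l = j then (if k = i then metric_comp A g c k l x else 0) else 0)"
    by (simp only: met_def)
  also have "\<dots> = (\<Sum>k\<in>UNIV. if k = i then metric_comp A g c k j x else 0)"
    by (simp only: sum.delta finite UNIV_I if_True)
  finally show ?thesis by simp
qed

theorem g2_tilde_frame:
  assumes u: "u \<in> slit_tangent_bundle A" and c: "c \<in> charts_at A (fst u)"
  shows "g2_tilde A g u (horizontal A g c i u) (horizontal A g c j u) = 0"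
    "g2_tilde A g u (vertical A c i u) (vertical A c j u) = 0"
    "g2_tilde A g u (horizontal A g c i u) (vertical A c j u) =
       2 / fibre_norm A g c u * metric_comp A g c i j (snd c (fst u))"
    "g2_tilde A g u (vertical A c j u) (horizontal A g c i u) =
       2 / fibre_norm A g c u * metric_comp A g c i j (snd c (fst u))"
  by (simp_all add: g2_tilde_chart[OF u c] frame_mem[OF u c] g2_chart_eq coframe_frame[OF u c]
      linear_0[OF met_linear(1)] linear_0[OF met_linear(2)] met_axis)

theorem Q_tilde_frame:
  assumes u: "u \<in> slit_tangent_bundle A" and c: "c \<in> charts_at A (fst u)"
  shows "Q_tilde A g u (horizontal A g c i u) = (\<lambda>d. fibre_norm A g c u *\<^sub>R vertical A c i u d)"
    "Q_tilde A g u (vertical A c i u) = (\<lambda>d. (1 / fibre_norm A g c u) *\<^sub>R horizontal A g c i u d)"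
proof -
  have "dx A c k \<xi> = DX c \<xi> $ k" "\<delta>y A g c k u \<xi> = DY c u \<xi> $ k" for k \<xi>
    by (simp_all add: DX_def DY_def)
  moreover have pick: "(\<Sum>k\<in>UNIV. (axis i 1 $ k * r) *\<^sub>R f k) = r *\<^sub>R f i"
    "(\<Sum>k\<in>UNIV. (axis i 1 $ k / r) *\<^sub>R f k) = (1 / r) *\<^sub>R f i"
    for r and f :: "'n \<Rightarrow> (real^'n) \<times> (real^'n)"
  proof -
    have "(axis i 1 $ k * r) *\<^sub>R f k = (if k = i then r *\<^sub>R f k else 0)"
      "(axis i 1 $ k / r) *\<^sub>R f k = (if k = i then (1 / r) *\<^sub>R f k else 0)" for k
      by (simp_all add: axis_def)
    then show "(\<Sum>k\<in>UNIV. (axis i 1 $ k * r) *\<^sub>R f k) = r *\<^sub>R f i"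
      "(\<Sum>k\<in>UNIV. (axis i 1 $ k / r) *\<^sub>R f k) = (1 / r) *\<^sub>R f i" by simp_all
  qed
  ultimately show "Q_tilde A g u (horizontal A g c i u) = (\<lambda>d. fibre_norm A g c u *\<^sub>R vertical A c i u d)"
    "Q_tilde A g u (vertical A c i u) = (\<lambda>d. (1 / fibre_norm A g c u) *\<^sub>R horizontal A g c i u d)"
    by (simp_all add: Q_tilde_chart[OF u c frame_mem(1)[OF u c]] Q_tilde_chart[OF u c frame_mem(2)[OF u c]]
        Q_chart_def coframe_frame[OF u c] pick)
qed

end

end

theory Submission
  imports Defs
begin

text \<open>In a chart, \<open>Q\<close> exchanges the two halves of the adapted coframe up to the mutually inverse
  factors \<open>\<parallel>y\<parallel>\<close> and \<open>1/\<parallel>y\<parallel>\<close>. So \<open>Q\<close> is an involution, and in \<open>g\<^sub>i\<^sub>j dx\<^sup>i \<delta>y\<^sup>j\<close> the factors cancel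
  while the swap is absorbed by the symmetry of \<open>g\<close>.\<close>

context riemannian_mfd
begin

lemma Q_tilde_Q_tilde:
  assumes u: "u \<in> slit_tangent_bundle A" and t: "\<xi> \<in> tangent_space (lift_atlas A) u"
  shows "Q_tilde A g u (Q_tilde A g u \<xi>) = \<xi>"
proof -
  note c = some_chart_mem[OF u]
  show ?thesis
    unfolding Q_tilde_def
    \<comment> \<open>A tangent vector is determined by its components \<open>DX\<close> and
      \<open>DY\<close>; a positive norm lets the two factors cancel.\<close>
    by (rule tangent_eqI_coframe[OF u c Q_chart_mem[OF u c] t])
      (use norm_pos[OF u c] in \<open>simp_all add: coframe_Q[OF u c]\<close>)
qed

text \<open>Both tensors are read in the same chosen chart, so no change of coordinates enters and
  \<open>coframe_Q\<close> applies directly.\<close>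

lemma g2_tilde_Q_tilde:
  assumes u: "u \<in> slit_tangent_bundle A"
  shows "g2_tilde A g u (Q_tilde A g u \<xi>) (Q_tilde A g u \<eta>) = g2_tilde A g u \<xi> \<eta>"
proof -
  define c where "c = some_chart A (fst u)"
  have c: "c \<in> charts_at A (fst u)"
    unfolding c_def by (rule some_chart_mem[OF u])
  let ?N = "fibre_norm A g c u" and ?m = "met A g c (snd c (fst u))"
  have "?m ((1 / ?N) *\<^sub>R v) (?N *\<^sub>R w) = ?m w v" for v w
    using norm_pos[OF u c] met_sym[OF c, of v w]
    by (simp add: linear_scale[OF met_linear(1)] linear_scale[OF met_linear(2)])
  \<comment> \<open>Each of the two summands in \<open>g2_chart_eq\<close> becomes the other one,
    hence \<open>add.commute\<close>.\<close>
  then show ?thesis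
    by (simp only: g2_tilde_def Q_tilde_def c_def[symmetric] g2_chart_eq coframe_Q[OF u c] add.commute)
qed

end

theorem theorem11:
  fixes X :: "'m topology"
    and A :: "('m, real^'n) chart set"
    and g :: "('m, real^'n) cov2"
  assumes "smooth_manifold X A"
    and "riemannian_metric A g"
  shows "(\<forall>u\<in>slit_tangent_bundle A. \<forall>\<xi>\<in>tangent_space (lift_atlas A) u.
            Q_tilde A g u (Q_tilde A g u \<xi>) = \<xi>) \<and>
         (\<forall>V W. smooth_vector_field (lift_atlas A) V \<longrightarrow> smooth_vector_field (lift_atlas A) W \<longrightarrow>
            (\<forall>u\<in>slit_tangent_bundle A.
               g2_tilde A g u (Q_tilde A g u (V u)) (Q_tilde A g u (W u)) = g2_tilde A g u (V u) (W u)))"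
proof -
  interpret riemannian_mfd X A g
    using assms by unfold_locales
  show ?thesis
    using Q_tilde_Q_tilde g2_tilde_Q_tilde by blast
qed

end
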